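(* Let $A_1$, $A_2$ be finite-dimensional complex vector spaces with $\mathbb{C}$-bases $(e_{1\cdot i})_i$ and $(e_{2\cdot j})_j$. Let $f:A_1\to A_2$ be an antilinear mapping, written in real coordinates (with respect to the associated real bases) as $y^{qj}=\sum_{p\in\{0,1\}}\sum_{i} f^{qj}_{pi}\,x^{pi}$, with $q\in\{0,1\}$ and $f^{qj}_{pi}\in\mathbb{R}$. Then for all $i,j$ $$f^{0j}_{0i}=-f^{1j}_{1i},\qquad f^{0j}_{1i}=f^{1j}_{0i}.$$
   Context: For a complex vector space $A$ with $\mathbb{C}$-basis $(e_i)$, the associated real basis consists of the vectors $e_{0i}=e_i$ and $e_{1i}=\mathrm{i}\,e_i$ ($\mathrm{i}$ the imaginary unit). The real coordinates $x^{0i},x^{1i}\in\mathbb{R}$ of $x\in A$ are defined by $x=\sum_i (x^{0i}+x^{1i}\mathrm{i})e_i$. A mapping $f:A_1\to A_2$ is antilinear if it is additive and $f(ca)=c^*f(a)$ for all $c\in\mathbb{C}$, $a\in A_1$, where $c^*$ is the complex conjugate of $c$ (in particular $f$ is real linear). *)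

theory Defs
  imports Complex_Main
begin

text \<open>A complex vector space is an additive group type with a scalar multiplication
  \<open>s :: complex \<Rightarrow> 'a \<Rightarrow> 'a\<close>. A finite indexed family \<open>(e i)\<^sub>i\<^sub>\<in>\<^sub>I\<close> is a basis iff \<open>e\<close> is injective on
  \<open>I\<close> and \<open>finite_dimensional_vector_space s (e ` I)\<close> holds, i.e. \<open>e ` I\<close> is finite, independent
  and spanning.\<close>

definition antilinear ::
  "(complex \<Rightarrow> 'a::ab_group_add \<Rightarrow> 'a) \<Rightarrow> (complex \<Rightarrow> 'b::ab_group_add \<Rightarrow> 'b) \<Rightarrow> ('a \<Rightarrow> 'b) \<Rightarrow> bool"
  where "antilinear s1 s2 f \<longleftrightarrow> additive f \<and> (\<forall>c a. f (s1 c a) = s2 (cnj c) (f a))"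

definition real_basis :: "(complex \<Rightarrow> 'a \<Rightarrow> 'a) \<Rightarrow> ('i \<Rightarrow> 'a) \<Rightarrow> nat \<Rightarrow> 'i \<Rightarrow> 'a"
  where "real_basis s e p i = (if p = 0 then e i else s \<i> (e i))"

text \<open>Only \<open>p = 0\<close> and \<open>p = 1\<close> are meaningful here and in \<open>real_basis\<close>. The lemmas below show that
  for a basis these are the unique real numbers \<open>x\<^sup>p\<^sup>i\<close> with
  \<open>x = (\<Sum>i\<in>I. (x\<^sup>0\<^sup>i + x\<^sup>1\<^sup>i \<i>) e\<^sub>i)\<close>.\<close>

definition real_coord ::
  "(complex \<Rightarrow> 'a::ab_group_add \<Rightarrow> 'a) \<Rightarrow> 'i set \<Rightarrow> ('i \<Rightarrow> 'a) \<Rightarrow> 'a \<Rightarrow> nat \<Rightarrow> 'i \<Rightarrow> real"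
  where "real_coord s I e x p i =
    (let c = module.representation s (e ` I) x (e i) in if p = 0 then Re c else Im c)"

lemma real_coord_expansion:
  assumes "finite_dimensional_vector_space s (e ` I)" "inj_on e I"
  shows "x = (\<Sum>i\<in>I. s (complex_of_real (real_coord s I e x 0 i)
                        + complex_of_real (real_coord s I e x 1 i) * \<i>) (e i))"
proof -
  interpret finite_dimensional_vector_space s "e ` I" by fact
  have c: "complex_of_real (real_coord s I e x 0 i) + complex_of_real (real_coord s I e x 1 i) * \<i>
      = representation (e ` I) x (e i)" for i
    by (simp add: real_coord_def complex_eq_iff)
  have "(\<Sum>b\<in>e ` I. s (representation (e ` I) x b) b) = x"
    by (rule sum_representation_eq)
      (use independent_Basis span_Basis finite_Basis in auto)
  then show ?thesis
    unfolding c using assms(2) by (simp add: sum.reindex)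
qed

lemma real_coord_unique:
  assumes "finite_dimensional_vector_space s (e ` I)" "inj_on e I"
    and x: "x = (\<Sum>i\<in>I. s (complex_of_real (X 0 i) + complex_of_real (X 1 i) * \<i>) (e i))"
    and "i \<in> I" "p \<in> {0, 1}"
  shows "X p i = real_coord s I e x p i"
proof -
  interpret finite_dimensional_vector_space s "e ` I" by fact
  define g where "g b = (if b \<in> e ` I then Complex (X 0 (the_inv_into I e b)) (X 1 (the_inv_into I e b)) else 0)" for b
  have g: "g (e k) = complex_of_real (X 0 k) + complex_of_real (X 1 k) * \<i>" if "k \<in> I" for k
    using that assms(2) by (simp add: g_def the_inv_into_f_f complex_eq_iff)
  have sup: "b \<in> e ` I" if "g b \<noteq> 0" for b
    using that by (auto simp: g_def split: if_splits)
  have fin: "finite {b. g b \<noteq> 0}"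
    by (rule finite_subset[OF _ finite_Basis]) (use sup in auto)
  have "(\<Sum>b | g b \<noteq> 0. s (g b) b) = (\<Sum>b\<in>e ` I. s (g b) b)"
    by (rule sum.mono_neutral_left) (use finite_Basis sup in auto)
  also have "\<dots> = (\<Sum>k\<in>I. s (g (e k)) (e k))"
    using assms(2) by (simp add: sum.reindex)
  also have "\<dots> = x"
    unfolding x by (rule sum.cong) (simp_all add: g)
  finally have "representation (e ` I) x = g"
    by (intro representation_eqI) (use independent_Basis span_Basis sup fin in auto)
  then show ?thesis
    using assms(4,5) g[OF assms(4)] by (auto simp: real_coord_def)
qed

lemma real_coord_real_basis_expansion:
  assumes "finite_dimensional_vector_space s (e ` I)" "inj_on e I"
  shows "x = (\<Sum>p\<in>{0, 1}. \<Sum>i\<in>I. s (complex_of_real (real_coord s I e x p i)) (real_basis s e p i))"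
proof -
  interpret finite_dimensional_vector_space s "e ` I" by fact
  show ?thesis
    by (subst real_coord_expansion[OF assms, of x])
      (simp add: real_basis_def scale_left_distrib sum.distrib)
qed

end

theory Submission
  imports Defs
begin

text \<open>Column \<open>(p, i)\<close> of the real matrix of \<open>f\<close> consists of the real coordinates of the image of the
  real basis vector \<open>e\<^sub>p\<^sub>i\<close>. Since \<open>f (\<i> e\<^sub>i) = - \<i> f (e\<^sub>i)\<close>, the column \<open>(1, i)\<close> arises from the column
  \<open>(0, i)\<close> through \<open>- \<i> (a + b \<i>) = b - a \<i>\<close>.\<close>

text \<open>Both real basis vectors for \<open>i\<close> are multiples of \<open>e i\<close>, so
  independence leaves only the coefficient at \<open>e i\<close>; injectivity of \<open>e\<close>
  turns \<open>e k = e i\<close> into \<open>k = i\<close>.\<close>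

lemma representation_real_basis:
  assumes "finite_dimensional_vector_space s (e ` I)" "inj_on e I" "i \<in> I" "k \<in> I"
  shows "module.representation s (e ` I) (real_basis s e p i) (e k) =
    (if k = i then if p = 0 then 1 else \<i> else 0)"
proof -
  interpret finite_dimensional_vector_space s "e ` I" by fact
  have "representation (e ` I) (e i) (e k) = (if k = i then 1 else 0)"
    using assms(2-4) independent_Basis by (auto simp: representation_basis inj_on_eq_iff)
  then show ?thesis
    by (auto simp: real_basis_def representation_scale independent_Basis span_Basis split: if_splits)
qed

lemma real_coord_real_basis:
  assumes "finite_dimensional_vector_space s (e ` I)" "inj_on e I" "i \<in> I" "k \<in> I"
    and "p \<in> {0, 1}" "q \<in> {0, 1}"
  shows "real_coord s I e (real_basis s e p i) q k = (if q = p \<and> k = i then 1 else 0)"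
  using assms(5,6) by (auto simp: real_coord_def representation_real_basis[OF assms(1-4)])

text \<open>Reads one coefficient off a real linear form: with \<open>G = F q j\<close> it recovers
  a matrix entry from the coordinate formula for \<open>f\<close>.\<close>

lemma sum_real_coord_real_basis:
  assumes "finite_dimensional_vector_space s (e ` I)" "inj_on e I" "i \<in> I" "p \<in> {0, 1}"
  shows "(\<Sum>q\<in>{0, 1}. \<Sum>k\<in>I. G q k * real_coord s I e (real_basis s e p i) q k) = G p i"
proof -
  interpret finite_dimensional_vector_space s "e ` I" by fact
  \<comment> \<open>Finiteness passes from the basis to its index set by injectivity; it lets the
    sum over \<open>I\<close> collapse to its term at \<open>i\<close>.\<close>
  have fin: "finite I"
    using finite_Basis assms(2) by (simp add: finite_image_iff)
  have "(\<Sum>q\<in>{0, 1}. \<Sum>k\<in>I. G q k * real_coord s I e (real_basis s e p i) q k) =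
      (\<Sum>q\<in>{0, 1}. \<Sum>k\<in>I. if k = i then if q = p then G q k else 0 else 0)"
    by (intro sum.cong refl) (use real_coord_real_basis[OF assms(1-3) _ assms(4)] in simp)
  also have "\<dots> = G p i"
    using assms(3,4) fin by auto
  finally show ?thesis .
qed

text \<open>Each coefficient is complex linear in the vector, so it gets multiplied by
  \<open>cnj \<i> = - \<i>\<close>; comparing real and imaginary parts gives both equations.\<close>

lemma real_coord_antilinear_imaginary:
  assumes "finite_dimensional_vector_space s2 (e2 ` J)" "antilinear s1 s2 f"
  shows "real_coord s2 J e2 (f (s1 \<i> a)) 0 j = real_coord s2 J e2 (f a) 1 j"
    and "real_coord s2 J e2 (f (s1 \<i> a)) 1 j = - real_coord s2 J e2 (f a) 0 j"
proof -
  interpret finite_dimensional_vector_space s2 "e2 ` J" by fact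
  have "representation (e2 ` J) (f (s1 \<i> a)) (e2 j) = - \<i> * representation (e2 ` J) (f a) (e2 j)"
    using assms(2) by (simp only: antilinear_def representation_scale[OF independent_Basis]
        span_Basis UNIV_I complex_cnj_i)
  then show "real_coord s2 J e2 (f (s1 \<i> a)) 0 j = real_coord s2 J e2 (f a) 1 j"
    and "real_coord s2 J e2 (f (s1 \<i> a)) 1 j = - real_coord s2 J e2 (f a) 0 j"
    by (simp_all add: real_coord_def)
qed

theorem theorem5p3:
  fixes s1 :: "complex \<Rightarrow> 'a::ab_group_add \<Rightarrow> 'a"
    and s2 :: "complex \<Rightarrow> 'b::ab_group_add \<Rightarrow> 'b"
    and I :: "'i set" and J :: "'j set"
    and e1 :: "'i \<Rightarrow> 'a" and e2 :: "'j \<Rightarrow> 'b"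
    and f :: "'a \<Rightarrow> 'b"
    and F :: "nat \<Rightarrow> 'j \<Rightarrow> nat \<Rightarrow> 'i \<Rightarrow> real"
  assumes "finite_dimensional_vector_space s1 (e1 ` I)" and "inj_on e1 I"
    and "finite_dimensional_vector_space s2 (e2 ` J)" and "inj_on e2 J"
    and "antilinear s1 s2 f"
    and "\<forall>x. \<forall>q\<in>{0, 1}. \<forall>j\<in>J. real_coord s2 J e2 (f x) q j =
           (\<Sum>p\<in>{0, 1}. \<Sum>i\<in>I. F q j p i * real_coord s1 I e1 x p i)"
  shows "\<forall>i\<in>I. \<forall>j\<in>J. F 0 j 0 i = - F 1 j 1 i \<and> F 0 j 1 i = F 1 j 0 i"
proof (intro ballI)
  fix i j
  assume i: "i \<in> I" and j: "j \<in> J"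
  \<comment> \<open>The coordinate formula is evaluated at
    \<open>x = real_basis s1 e1 p i\<close>.\<close>
  have col: "F q j p i = real_coord s2 J e2 (f (real_basis s1 e1 p i)) q j"
    if "p \<in> {0, 1}" "q \<in> {0, 1}" for p q
    using bspec[OF bspec[OF spec[OF assms(6)] that(2)] j]
      sum_real_coord_real_basis[OF assms(1,2) i that(1)] by simp
  \<comment> \<open>Taking \<open>a = e1 i\<close> compares columns \<open>(1, i)\<close> and
    \<open>(0, i)\<close>: row 0 gives the second equation, row 1 the first.\<close>
  show "F 0 j 0 i = - F 1 j 1 i \<and> F 0 j 1 i = F 1 j 0 i"
    using real_coord_antilinear_imaginary[OF assms(3,5), of "e1 i" j]
    by (simp add: col real_basis_def)
qed

end
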